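(* Let $n\ge1$, $\mu>0$, $a_1,\dots,a_n\ge0$, $a_0=0$, and $\beta_i,\lambda_i>0$, $i=1,\dots,n$. Define $X_0(t)=t$ and, for $i=1,\dots,n$, $X_i(t)=E_i(a_it+N_i(X_{i-1}(t)))$, where $E_1,\dots,E_n$ are exponential processes with parameters $\beta_1,\dots,\beta_n$, $N_1,\dots,N_n$ are Poisson processes with intensities $\lambda_1,\dots,\lambda_n$, and all are independent. Let $N_\mu$ be a Poisson process with intensity $\mu$ independent of $X_n$. Then the probabilities $p_k(t)=P\{N_\mu(X_n(t))=k\}$, $k\ge0$, are solutions to the equation $$\frac{d}{dt}p_k(t)=-\sum_{j=0}^{n}f_{n,j}\bigl(\mu(I-B)\bigr)p_k(t),\qquad k\ge0,\ t>0,$$ with initial condition $p_0(0)=1$, $p_k(0)=0$ for $k\ge1$, where $f_{n,j}$ are given as follows: (i) if $\beta_i=\lambda_i=1$ for $i=1,\dots,n$, then $$f_{n,j}(u)=(a_{n-j}-a_{n-j-1})\log(1+(1+j)u),\quad j=0,1,\dots,n-1;\qquad f_{n,n}(u)=\frac{u}{1+nu};$$ (ii) if $\beta_i=\beta\ne1$ and $\lambda_i=\lambda\ne1$ for $i=1,\dots,n$, then $$f_{n,j}(u)=(a_{n-j}-a_{n-j-1})\log\left(1+u\frac{\gamma(\lambda,\beta,j+1)}{\beta^{j+1}}\right),\quad j=0,1,\dots,n-1;\qquad f_{n,n}(u)=\frac{\lambda^nu}{\beta^n+u\gamma(\lambda,\beta,n)},$$ where $\gamma(\lambda,\beta,m)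=\sum_{j=1}^{m}\lambda^{m-j}\beta^{j-1}$.
   Context: The exponential process with parameter $\beta$ is the subordinator with Laplace exponent $\log(1+u/\beta)$ (the Gamma process with shape parameter $1$ and rate $\beta$). $I$ is the identity and $B$ the shift operator in $k$: $Bp_k(t)=p_{k-1}(t)$, with the convention $p_k(t)=0$ for $k<0$. For a function $f$ smooth near $\mu$, $f(\mu(I-B))$ is understood via the expansion in powers of $B$: $f(\mu(I-B))p_k(t)=\sum_{m=0}^{k}\frac{(-\mu)^m}{m!}f^{(m)}(\mu)\,p_{k-m}(t)$; when $f(u)=\int_0^\infty(1-e^{-us})\nu(ds)$ this equals $f(\mu)p_k(t)-\sum_{m=1}^k\frac{\mu^m}{m!}p_{k-m}(t)\int_0^\infty e^{-s\mu}s^m\nu(ds)$. *)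

theory Defs
  imports "HOL-Probability.Probability"
begin

text \<open>
  Processes are indexed by real time but only times \<open>t \<ge> 0\<close> matter. Path properties are
  required for every sample point, the usual normalisation of an almost sure property:
  processes are evaluated at random times below, and this makes the compositions measurable
  without completing the probability space. Left limits exist by monotonicity.
\<close>

context prob_space
begin

definition subordinator :: "(real \<Rightarrow> 'a \<Rightarrow> real) \<Rightarrow> bool" where
  "subordinator X \<longleftrightarrow>
     (\<forall>t\<ge>0. random_variable borel (X t)) \<and>
     (\<forall>\<omega>\<in>space M. X 0 \<omega> = 0) \<and>
     (\<forall>\<omega>\<in>space M. mono_on {0..} (\<lambda>t. X t \<omega>)) \<and>
     (\<forall>\<omega>\<in>space M. \<forall>t\<ge>0. continuous (at_right t) (\<lambda>s. X s \<omega>)) \<and>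
     (\<forall>(\<tau> :: nat \<Rightarrow> real) m. 0 \<le> \<tau> 0 \<longrightarrow> mono \<tau> \<longrightarrow>
        indep_vars (\<lambda>_. borel) (\<lambda>j \<omega>. X (\<tau> (Suc j)) \<omega> - X (\<tau> j) \<omega>) {..<m}) \<and>
     (\<forall>s\<ge>0. \<forall>t\<ge>0. distr M borel (\<lambda>\<omega>. X (s + t) \<omega> - X s \<omega>) = distr M borel (X t))"

definition has_laplace_exponent :: "(real \<Rightarrow> 'a \<Rightarrow> real) \<Rightarrow> (real \<Rightarrow> real) \<Rightarrow> bool" where
  "has_laplace_exponent X \<phi> \<longleftrightarrow>
     (\<forall>t\<ge>0. \<forall>u\<ge>0. expectation (\<lambda>\<omega>. exp (- u * X t \<omega>)) = exp (- t * \<phi> u))"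

definition exponential_process :: "real \<Rightarrow> (real \<Rightarrow> 'a \<Rightarrow> real) \<Rightarrow> bool" where
  "exponential_process \<beta> E \<longleftrightarrow> subordinator E \<and> has_laplace_exponent E (\<lambda>u. ln (1 + u / \<beta>))"

text \<open>At \<open>t = 0\<close> the value is fixed by the subordinator property;
  \<^const>\<open>poisson_pmf\<close> is only meaningful for a positive rate.\<close>

definition poisson_process :: "real \<Rightarrow> (real \<Rightarrow> 'a \<Rightarrow> nat) \<Rightarrow> bool" where
  "poisson_process r N \<longleftrightarrow> subordinator (\<lambda>t \<omega>. real (N t \<omega>)) \<and>
     (\<forall>t>0. distr M (count_space UNIV) (N t) = measure_pmf (poisson_pmf (r * t)))"

end

definition path_space :: "(real \<Rightarrow> real) measure" where
  "path_space = (\<Pi>\<^sub>M t\<in>{0..}. borel)"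

definition sample_path :: "(real \<Rightarrow> 'a \<Rightarrow> real) \<Rightarrow> 'a \<Rightarrow> real \<Rightarrow> real" where
  "sample_path X \<omega> = (\<lambda>t\<in>{0..}. X t \<omega>)"

primrec iter_process ::
  "(nat \<Rightarrow> real) \<Rightarrow> (nat \<Rightarrow> real \<Rightarrow> 'a \<Rightarrow> real) \<Rightarrow> (nat \<Rightarrow> real \<Rightarrow> 'a \<Rightarrow> nat) \<Rightarrow>
   nat \<Rightarrow> real \<Rightarrow> 'a \<Rightarrow> real" where
  "iter_process a E N 0 = (\<lambda>t \<omega>. t)"
| "iter_process a E N (Suc i) = (\<lambda>t \<omega>.
     E (Suc i) (a (Suc i) * t + real (N (Suc i) (iter_process a E N i t \<omega>) \<omega>)) \<omega>)"

text \<open>The operator \<open>f (\<mu> (I - B))\<close>, expanded in powers of the shift \<open>B\<close>, on sequences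
  extended by zero to negative indices, so that \<open>B\<^sup>m p\<close> at \<open>k\<close> vanishes for \<open>m > k\<close>.\<close>

definition fun_of_shift :: "(real \<Rightarrow> real) \<Rightarrow> real \<Rightarrow> (nat \<Rightarrow> real) \<Rightarrow> nat \<Rightarrow> real" where
  "fun_of_shift f \<mu> p k = (\<Sum>m\<le>k. (- \<mu>) ^ m / fact m * (deriv ^^ m) f \<mu> * p (k - m))"

definition solves_shift_equation ::
  "nat \<Rightarrow> (nat \<Rightarrow> real \<Rightarrow> real) \<Rightarrow> real \<Rightarrow> (nat \<Rightarrow> real \<Rightarrow> real) \<Rightarrow> bool" where
  "solves_shift_equation n f \<mu> p \<longleftrightarrow>
     (\<forall>k. \<forall>t>0. ((\<lambda>s. p k s) has_real_derivative
        - (\<Sum>j=0..n. fun_of_shift (f j) \<mu> (\<lambda>i. p i t) k)) (at t)) \<and>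
     p 0 0 = 1 \<and> (\<forall>k\<ge>1. p k 0 = 0)"

definition gamma_sum :: "real \<Rightarrow> real \<Rightarrow> nat \<Rightarrow> real" where
  "gamma_sum l b m = (\<Sum>j=1..m. l ^ (m - j) * b ^ (j - 1))"

definition f_unit :: "(nat \<Rightarrow> real) \<Rightarrow> nat \<Rightarrow> nat \<Rightarrow> real \<Rightarrow> real" where
  "f_unit a n j u =
     (if j < n then (a (n - j) - a (n - j - 1)) * ln (1 + (1 + real j) * u)
      else u / (1 + real n * u))"

definition f_general :: "real \<Rightarrow> real \<Rightarrow> (nat \<Rightarrow> real) \<Rightarrow> nat \<Rightarrow> nat \<Rightarrow> real \<Rightarrow> real" where
  "f_general l b a n j u =
     (if j < n
      then (a (n - j) - a (n - j - 1)) * ln (1 + u * (gamma_sum l b (j + 1) / b ^ (j + 1)))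
      else l ^ n * u / (b ^ n + u * gamma_sum l b n))"

end

theory Submission
  imports Defs
begin

text \<open>
  Conditioning on the time argument at each stage gives the Laplace exponent of \<open>X\<^sub>n\<close> by the
  recursion \<open>\<Phi>\<^sub>i(u) = a\<^sub>i ln (1 + u/\<beta>) + \<Phi>\<^bsub>i-1\<^esub>(\<lambda>u / (\<beta> + u))\<close>, which telescopes to the sum of
  the \<open>f\<^bsub>n,j\<^esub>\<close>. Hence the generating function of \<open>p\<^sub>k(t)\<close> is \<open>exp (- t F(z))\<close> with
  \<open>F(z) = \<Phi>\<^sub>n(\<mu>(1 - z))\<close>, and the coefficients of \<open>F\<close> at \<open>z = 0\<close> are those of the shift operator
  \<open>\<Phi>\<^sub>n(\<mu>(I - B))\<close>. The \<open>z\<close>-derivative of \<open>exp (- t F(z))\<close> yields a recursion for the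
  \<open>p\<^sub>k(t)\<close>, from which differentiability in \<open>t\<close> and the equation follow by induction on \<open>k\<close>,
  with no differentiation under the expectation. Case (i) is the formula of case (ii) at
  \<open>\<beta> = \<lambda> = 1\<close>.
\<close>

subsection \<open>Power series of real functions\<close>

lemma has_fps_expansion_0_eq:
  fixes f :: "real \<Rightarrow> real"
  assumes "f has_fps_expansion F"
  shows "f 0 = fps_nth F 0"
  using assms by (auto simp: has_fps_expansion_def eval_fps_at_0 dest: eventually_nhds_x_imp_x)

lemma fps_nth_real_fps_expansion:
  fixes f :: "real \<Rightarrow> real"
  assumes "f has_fps_expansion F"
  shows "fps_nth F n = (deriv ^^ n) f 0 / fact n"
  using assms
proof (induction n arbitrary: f F)
  case 0
  then show ?case by (simp add: has_fps_expansion_0_eq)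
next
  case (Suc n)
  have "fps_nth (fps_deriv F) n = (deriv ^^ n) (deriv f) 0 / fact n"
    by (rule Suc.IH[OF has_fps_expansion_deriv[OF Suc.prems]])
  then show ?case
    by (simp add: funpow_swap1 field_simps del: of_nat_Suc)
qed

text \<open>The coefficients are Taylor coefficients at 0, and higher derivatives at a point depend
  only on the germ there.\<close>

lemma real_fps_expansion_unique:
  fixes f g :: "real \<Rightarrow> real"
  assumes "f has_fps_expansion F" "g has_fps_expansion G"
    and "eventually (\<lambda>z. f z = g z) (nhds 0)"
  shows "F = G"
proof (rule fps_ext)
  fix n
  have "(deriv ^^ n) f 0 = (deriv ^^ n) g 0"
    by (rule higher_deriv_cong_ev[OF assms(3) refl])
  then show "fps_nth F n = fps_nth G n"
    using fps_nth_real_fps_expansion[OF assms(1)] fps_nth_real_fps_expansion[OF assms(2)] by simp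
qed

lemma has_fps_expansion_scale:
  fixes f :: "real \<Rightarrow> real"
  assumes "f has_fps_expansion F"
  shows "(\<lambda>z. f (c * z)) has_fps_expansion Abs_fps (\<lambda>n. fps_nth F n * c ^ n)"
proof (rule has_fps_expansionI)
  have "eventually (\<lambda>z. z \<in> eball 0 (fps_conv_radius F)) (nhds 0)"
    using assms by (intro eventually_nhds_in_open) (auto simp: has_fps_expansion_def zero_ereal_def)
  moreover have "eventually (\<lambda>z. eval_fps F z = f z) (nhds 0)"
    using assms by (simp add: has_fps_expansion_def)
  ultimately have "eventually (\<lambda>z. (\<lambda>n. fps_nth F n * z ^ n) sums f z) (nhds 0)"
  proof eventually_elim
    case (elim z)
    then have "summable (\<lambda>n. fps_nth F n * z ^ n)"
      by (intro summable_fps) (auto simp: in_eball_iff)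
    with elim show ?case by (simp add: eval_fps_def sums_iff)
  qed
  moreover have "filterlim (\<lambda>z. c * z) (nhds 0) (nhds (0::real))"
  proof -
    have "((\<lambda>z. c * z) \<longlongrightarrow> c * 0) (nhds 0)"
      by (intro tendsto_mult tendsto_const filterlim_ident)
    then show ?thesis by simp
  qed
  ultimately have "eventually (\<lambda>z. (\<lambda>n. fps_nth F n * (c * z) ^ n) sums f (c * z)) (nhds 0)"
    by (rule eventually_compose_filterlim)
  then show "eventually (\<lambda>z. (\<lambda>n. fps_nth (Abs_fps (\<lambda>n. fps_nth F n * c ^ n)) n * z ^ n) sums f (c * z)) (nhds 0)"
    by (simp add: power_mult_distrib mult.assoc)
qed

lemma eventually_differentiable_fps_expansion:
  fixes f :: "real \<Rightarrow> real"
  assumes "f has_fps_expansion F"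
  shows "eventually (\<lambda>z. f field_differentiable at z) (nhds 0)"
proof -
  have "eventually (\<lambda>z. z \<in> eball 0 (fps_conv_radius F)) (nhds 0)"
    using assms by (intro eventually_nhds_in_open) (auto simp: has_fps_expansion_def zero_ereal_def)
  \<comment> \<open>Equality with the power series is needed near \<open>z\<close>, not merely at
    \<open>z\<close>, for the derivative to carry over.\<close>
  moreover have "eventually (\<lambda>z. eventually (\<lambda>w. eval_fps F w = f w) (nhds z)) (nhds 0)"
    using assms by (subst eventually_eventually) (simp add: has_fps_expansion_def)
  ultimately show ?thesis
  proof eventually_elim
    case (elim z)
    have "(eval_fps F has_field_derivative eval_fps (fps_deriv F) z) (at z)"
      using elim by (intro has_field_derivative_eval_fps) (auto simp: in_eball_iff)
    then have "(f has_field_derivative eval_fps (fps_deriv F) z) (at z)"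
      using DERIV_cong_ev[OF refl elim(2) refl] by simp
    then show ?case by (auto simp: field_differentiable_def)
  qed
qed

section \<open>Differentiating \<open>exp (- t * F z)\<close> in \<open>z\<close> and in
  \<open>t\<close>\<close>

lemma fps_expansion_exp_ode:
  fixes F G :: "real \<Rightarrow> real"
  assumes F: "F has_fps_expansion C" and G: "G has_fps_expansion P"
    and eq: "eventually (\<lambda>z. G z = exp (- t * F z)) (nhds 0)"
  shows "fps_nth P 0 = exp (- t * fps_nth C 0)"
    and "fps_deriv P = fps_const (- t) * (fps_deriv C * P)"
proof -
  show "fps_nth P 0 = exp (- t * fps_nth C 0)"
    using eventually_nhds_x_imp_x[OF eq] has_fps_expansion_0_eq[OF F] has_fps_expansion_0_eq[OF G]
    by simp
  have "eventually (\<lambda>z. eventually (\<lambda>w. G w = exp (- t * F w)) (nhds z)) (nhds 0)"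
    using eq by (subst eventually_eventually)
  \<comment> \<open>Writing the exponential factor as \<open>G z\<close> again makes the equation
    linear in \<open>G\<close>, so that it can be read among formal series.\<close>
  then have "eventually (\<lambda>z. deriv G z = - t * (deriv F z * G z)) (nhds 0)"
    using eventually_differentiable_fps_expansion[OF F] eq
  proof eventually_elim
    case (elim z)
    have "(F has_field_derivative deriv F z) (at z)"
      using elim by (simp add: field_differentiable_derivI)
    then have "((\<lambda>w. exp (- t * F w)) has_field_derivative exp (- t * F z) * (- t * deriv F z)) (at z)"
      by (auto intro!: derivative_eq_intros)
    then have "(G has_field_derivative exp (- t * F z) * (- t * deriv F z)) (at z)"
      using DERIV_cong_ev[OF refl elim(1) refl] by simp
    then show ?case using elim by (simp add: DERIV_imp_deriv)
  qed
  moreover have "(\<lambda>z. - t * (deriv F z * G z)) has_fps_expansion fps_const (- t) * (fps_deriv C * P)"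
    by (intro has_fps_expansion_cmult_left has_fps_expansion_mult has_fps_expansion_deriv F G)
  ultimately show "fps_deriv P = fps_const (- t) * (fps_deriv C * P)"
    using has_fps_expansion_deriv[OF G] real_fps_expansion_unique by blast
qed

text \<open>Formally \<open>P s\<close> is the exponential of \<open>- s C\<close>, so its
  derivative in \<open>s\<close> is \<open>- C * P s\<close>. Coefficient 0 is an honest
  exponential; by the equation in \<open>z\<close>, each later coefficient is an explicit expression
  in \<open>s\<close> and coefficients of smaller index, so strong induction gives differentiability
  and the derivative together.\<close>

lemma fps_exp_flow:
  fixes P :: "real \<Rightarrow> real fps" and C :: "real fps"
  assumes P0: "\<And>s. s > 0 \<Longrightarrow> fps_nth (P s) 0 = exp (- s * fps_nth C 0)"
    and dP: "\<And>s. s > 0 \<Longrightarrow> fps_deriv (P s) = fps_const (- s) * (fps_deriv C * P s)"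
    and t: "t > 0"
  shows "((\<lambda>s. fps_nth (P s) k) has_real_derivative - fps_nth (C * P t) k) (at t)"
proof (induction k rule: less_induct)
  case (less k)
  show ?case
  proof (cases k)
    case 0
    have "((\<lambda>s. exp (- s * fps_nth C 0)) has_real_derivative - fps_nth (C * P t) k) (at t)"
      using P0[OF t] 0 by (auto intro!: derivative_eq_intros simp: fps_mult_nth)
    then show ?thesis
      by (rule has_field_derivative_transform_within_open[where S="{0<..}"]) (use t P0 0 in auto)
  next
    case (Suc m)
    define Q where "Q = fps_deriv C"
    \<comment> \<open>Coefficient \<open>m\<close> of \<open>fps_deriv (P s)\<close> is
      \<open>k\<close> times coefficient \<open>k = Suc m\<close> of \<open>P s\<close>, while the
      convolution reaches only indices up to \<open>m\<close>.\<close>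
    have rec: "fps_nth (P s) k = - s / real k * (\<Sum>i=0..m. fps_nth Q i * fps_nth (P s) (m - i))"
      if "s > 0" for s
    proof -
      have "fps_nth (fps_deriv (P s)) m = - s * fps_nth (Q * P s) m"
        using dP[OF that] by (simp add: Q_def)
      then show ?thesis by (simp add: Suc fps_mult_nth field_simps del: of_nat_Suc)
    qed
    have "((\<lambda>s. - s / real k * (\<Sum>i=0..m. fps_nth Q i * fps_nth (P s) (m - i))) has_real_derivative
       - 1 / real k * (\<Sum>i=0..m. fps_nth Q i * fps_nth (P t) (m - i)) +
       (\<Sum>i=0..m. fps_nth Q i * - fps_nth (C * P t) (m - i)) * (- t / real k)) (at t)"
      by (intro DERIV_mult DERIV_sum DERIV_cmult DERIV_cdivide DERIV_minus DERIV_ident less) (simp add: Suc)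
    then have D: "((\<lambda>s. fps_nth (P s) k) has_real_derivative
       - 1 / real k * (\<Sum>i=0..m. fps_nth Q i * fps_nth (P t) (m - i)) +
       (\<Sum>i=0..m. fps_nth Q i * - fps_nth (C * P t) (m - i)) * (- t / real k)) (at t)"
      by (rule has_field_derivative_transform_within_open[where S="{0<..}"]) (use t rec in auto)
    \<comment> \<open>To recognise the derivative in \<open>D\<close>, the product
      \<open>C * P t\<close> is itself differentiated in \<open>z\<close>: its coefficient
      \<open>k\<close> turns out to be built from the same two convolutions with
      \<open>Q\<close>.\<close>
    have "fps_deriv (C * P t) = Q * P t + C * (fps_const (- t) * (Q * P t))"
      using dP[OF t] by (simp add: Q_def algebra_simps)
    also have "\<dots> = Q * P t + fps_const (- t) * (Q * (C * P t))"
      by (simp add: algebra_simps)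
    finally have "fps_nth (fps_deriv (C * P t)) m = fps_nth (Q * P t) m - t * fps_nth (Q * (C * P t)) m"
      by simp
    then have "real k * fps_nth (C * P t) k = fps_nth (Q * P t) m - t * fps_nth (Q * (C * P t)) m"
      by (simp add: Suc del: of_nat_Suc fps_deriv_mult)
    then have "- fps_nth (C * P t) k = - 1 / real k * fps_nth (Q * P t) m + - fps_nth (Q * (C * P t)) m * (- t / real k)"
      using Suc by (simp add: field_simps del: of_nat_Suc)
    then show ?thesis using D
      by (simp add: fps_mult_nth[of Q] sum_negf)
  qed
qed

section \<open>The shift operator as multiplication by a power series\<close>

definition shift_fps :: "(real \<Rightarrow> real) \<Rightarrow> real \<Rightarrow> real fps" where
  "shift_fps f \<mu> = Abs_fps (\<lambda>m. (- \<mu>) ^ m / fact m * (deriv ^^ m) f \<mu>)"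

text \<open>On coefficient sequences \<open>B\<close> is multiplication by the formal variable, so a
  power series in \<open>B\<close> acts by Cauchy product; stopping at \<open>m \<le> k\<close>
  matches the extension by zero to negative indices.\<close>

lemma fun_of_shift_eq_fps_mult: "fun_of_shift f \<mu> p k = fps_nth (shift_fps f \<mu> * Abs_fps p) k"
  by (simp add: fun_of_shift_def shift_fps_def fps_mult_nth atLeast0AtMost)

text \<open>Substituting \<open>x = - \<mu> * z\<close> in the Taylor series of \<open>f\<close> at
  \<open>\<mu>\<close> multiplies coefficient \<open>m\<close> by
  \<open>(- \<mu>) ^ m\<close>.\<close>

lemma has_fps_expansion_shift_fps:
  assumes "(\<lambda>x. f (\<mu> + x)) has_fps_expansion K"
  shows "(\<lambda>z. f (\<mu> * (1 - z))) has_fps_expansion shift_fps f \<mu>"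
proof -
  have "fps_nth K m = (deriv ^^ m) f \<mu> / fact m" for m
    using fps_nth_real_fps_expansion[OF assms, of m] higher_deriv_shift_0[of m f \<mu>]
    by (simp add: o_def)
  then have "shift_fps f \<mu> = Abs_fps (\<lambda>m. fps_nth K m * (- \<mu>) ^ m)"
    by (simp add: shift_fps_def fps_eq_iff)
  with has_fps_expansion_scale[OF assms, of "- \<mu>"] show ?thesis
    by (simp add: algebra_simps)
qed

lemma has_fps_expansion_ln_affine:
  fixes A c :: real
  assumes "A > 0"
  shows "\<exists>F. (\<lambda>x. ln (A + c * x)) has_fps_expansion F"
proof -
  have "eventually (\<lambda>x::real. \<bar>x\<bar> < 1) (nhds 0)"
    by (rule eventually_nhds_metric[THEN iffD2]) (auto intro!: exI[of _ 1])
  \<comment> \<open>At \<open>n = 0\<close> the division by zero yields the coefficient 0, which is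
    the correct value of \<open>ln 1\<close>.\<close>
  then have "(\<lambda>x::real. ln (1 + x)) has_fps_expansion Abs_fps (\<lambda>n. - ((- 1) ^ n) / of_nat n)"
  proof (intro has_fps_expansionI, elim eventually_mono)
    fix x :: real assume x: "\<bar>x\<bar> < 1"
    have "(- x) ^ n = (- 1) ^ n * x ^ n" for n
      by (rule power_minus)
    with ln_series'[OF x]
    show "(\<lambda>n. fps_nth (Abs_fps (\<lambda>n. - ((- 1) ^ n) / of_nat n)) n * x ^ n) sums ln (1 + x)"
      by simp
  qed
  from has_fps_expansion_add[OF has_fps_expansion_const has_fps_expansion_scale[OF this, of "c / A"], of "ln A"]
  obtain F where F: "(\<lambda>x. ln A + ln (1 + c / A * x)) has_fps_expansion F" by blast
  have "((\<lambda>x. 1 + c / A * x) \<longlongrightarrow> 1 + c / A * 0) (nhds 0)"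
    by (intro tendsto_intros filterlim_ident)
  then have "eventually (\<lambda>x. 1 + c / A * x > 0) (nhds 0)"
    by (rule order_tendstoD) simp
  then have "eventually (\<lambda>x. ln A + ln (1 + c / A * x) = ln (A + c * x)) (nhds 0)"
  proof eventually_elim
    case (elim x)
    have "A + c * x = A * (1 + c / A * x)" using assms by (simp add: field_simps)
    then show ?case using assms elim by (simp add: ln_mult)
  qed
  with F have "(\<lambda>x. ln (A + c * x)) has_fps_expansion F"
    unfolding has_fps_expansion_def by (auto elim: eventually_elim2)
  then show ?thesis by blast
qed

section \<open>Algebra of the functions \<open>f_general\<close> and of the Laplace
  exponents\<close>

lemma gamma_sum_nonneg: "l > 0 \<Longrightarrow> b > 0 \<Longrightarrow> gamma_sum l b m \<ge> 0"
  unfolding gamma_sum_def by (intro sum_nonneg) simp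

lemma gamma_sum_Suc: "gamma_sum l b (Suc m) = l ^ m + b * gamma_sum l b m"
proof -
  have "gamma_sum l b (Suc m) = (\<Sum>j=0..m. l ^ (m - j) * b ^ j)"
    unfolding gamma_sum_def by (simp only: One_nat_def sum.atLeast_Suc_atMost_Suc_shift) simp
  also have "\<dots> = l ^ m + (\<Sum>j=1..m. l ^ (m - j) * b ^ j)"
    by (simp add: sum.atLeast_Suc_atMost)
  also have "(\<Sum>j=1..m. l ^ (m - j) * b ^ j) = b * gamma_sum l b m"
    unfolding gamma_sum_def sum_distrib_left
    by (intro sum.cong refl) (auto simp: algebra_simps simp flip: power_Suc)
  finally show ?thesis .
qed

text \<open>Nonnegativity of \<open>gamma_sum\<close> keeps the argument of the logarithm and the
  denominator positive at \<open>\<mu>\<close>, so each function is analytic there.\<close>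

lemma f_general_has_fps_expansion:
  assumes "l > 0" "b > 0" "\<mu> > 0"
  shows "(\<lambda>z. f_general l b a n j (\<mu> * (1 - z))) has_fps_expansion shift_fps (f_general l b a n j) \<mu>"
proof -
  have "\<exists>K. (\<lambda>x. f_general l b a n j (\<mu> + x)) has_fps_expansion K"
  proof (cases "j < n")
    case True
    define c where "c = gamma_sum l b (j + 1) / b ^ (j + 1)"
    have "c \<ge> 0" using assms gamma_sum_nonneg unfolding c_def by simp
    then have "1 + c * \<mu> > 0" using assms by (simp add: add_pos_nonneg)
    from has_fps_expansion_ln_affine[OF this, of c]
    obtain F where "(\<lambda>x. ln (1 + c * \<mu> + c * x)) has_fps_expansion F" by blast
    then have "(\<lambda>x. (a (n - j) - a (n - j - 1)) * ln (1 + c * \<mu> + c * x)) has_fps_expansion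
       fps_const (a (n - j) - a (n - j - 1)) * F"
      by (rule has_fps_expansion_cmult_left)
    moreover have "(\<lambda>x. f_general l b a n j (\<mu> + x)) =
       (\<lambda>x. (a (n - j) - a (n - j - 1)) * ln (1 + c * \<mu> + c * x))"
    proof
      fix x
      have "1 + (\<mu> + x) * c = 1 + c * \<mu> + c * x" by (simp add: algebra_simps)
      then show "f_general l b a n j (\<mu> + x) = (a (n - j) - a (n - j - 1)) * ln (1 + c * \<mu> + c * x)"
        using True by (simp only: f_general_def if_True flip: c_def)
    qed
    ultimately show ?thesis by auto
  next
    case False
    have "b ^ n + \<mu> * gamma_sum l b n > 0"
      using assms gamma_sum_nonneg[of l b n] by (simp add: add_pos_nonneg)
    then have "(\<lambda>x. l ^ n * (\<mu> + x) / (b ^ n + (\<mu> + x) * gamma_sum l b n)) has_fps_expansion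
       fps_const (l ^ n) * (fps_const \<mu> + fps_X) /
       (fps_const (b ^ n) + (fps_const \<mu> + fps_X) * fps_const (gamma_sum l b n))"
      by (intro fps_expansion_intros) auto
    then show ?thesis using False by (auto simp: f_general_def)
  qed
  then show ?thesis using has_fps_expansion_shift_fps by blast
qed

text \<open>With both parameters 1 every summand of \<open>gamma_sum\<close> is 1, so its value is
  the number of summands.\<close>

lemma f_unit_eq_f_general: "f_unit a n = f_general 1 1 a n"
  by (simp add: fun_eq_iff f_unit_def f_general_def gamma_sum_def algebra_simps)

text \<open>The Laplace exponent of the \<open>i\<close>-th iterate. The inner argument is the
  Poisson exponent \<open>l * (1 - z)\<close> at \<open>z = b / (b + u)\<close>, that is, at
  \<open>z = exp (- ln (1 + u / b))\<close>.\<close>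

primrec iter_exponent :: "real \<Rightarrow> real \<Rightarrow> (nat \<Rightarrow> real) \<Rightarrow> nat \<Rightarrow> real \<Rightarrow> real" where
  "iter_exponent l b a 0 u = u"
| "iter_exponent l b a (Suc i) u = a (Suc i) * ln (1 + u / b) + iter_exponent l b a i (l * u / (b + u))"

text \<open>Substituting \<open>l * u / (b + u)\<close> for \<open>u\<close> raises the index of
  \<open>gamma_sum\<close> by one. In the logarithmic case a factor \<open>1 + u / b\<close> splits
  off, and its logarithm keeps the same coefficient since \<open>Suc n - Suc j = n - j\<close>; in
  the rational case the factor \<open>b + u\<close> cancels.\<close>

lemma f_general_Suc_Suc:
  assumes "l > 0" "b > 0" "u \<ge> 0" 
  shows "f_general l b a (Suc n) (Suc j) u = 
    f_general l b a n j (l * u / (b + u)) + (if j < n then (a (n - j) - a (n - j - 1)) * ln (1 + u / b) else 0)"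
proof -
  have bu: "b + u > 0" using assms by simp
  \<comment> \<open>The mirror image of \<open>gamma_sum_Suc\<close>, which removes the pure power
    of \<open>b\<close> instead of that of \<open>l\<close>; this form fits the
    substitution.\<close>
  have g: "gamma_sum l b (Suc m) = b ^ m + l * gamma_sum l b m" for m
  proof (induction m)
    case (Suc m)
    have "gamma_sum l b (Suc (Suc m)) = l ^ Suc m + b * (b ^ m + l * gamma_sum l b m)"
      by (simp only: gamma_sum_Suc[of l b "Suc m"] Suc)
    also have "\<dots> = b ^ Suc m + l * (l ^ m + b * gamma_sum l b m)"
      by (simp add: algebra_simps)
    finally show ?case by (simp only: gamma_sum_Suc[of l b m])
  qed (simp add: gamma_sum_def)
  have gs: "gamma_sum l b m \<ge> 0" for m using gamma_sum_nonneg assms by simp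
  show ?thesis
  proof (cases "j < n")
    case True
    define G where "G = gamma_sum l b (Suc j)"
    define B where "B = b ^ Suc j"
    have B: "B > 0" "G \<ge> 0" using assms gs by (simp_all add: B_def G_def)
    have "1 + u * gamma_sum l b (Suc (Suc j)) / b ^ (Suc (Suc j)) = 
      (1 + u / b) * (1 + l * u / (b + u) * G / B)"
      unfolding g[of "Suc j"] G_def[symmetric] power_Suc[of b "Suc j"] B_def[symmetric]
      using assms bu B by (simp add: divide_simps) (simp add: algebra_simps)
    moreover have "1 + u / b > 0" "1 + l * u / (b + u) * G / B > 0"
      using assms bu B by (simp_all add: add_pos_nonneg)
    ultimately show ?thesis using True
      by (simp only: f_general_def ln_mult ln_mult_pos Suc_eq_plus1[symmetric] G_def[symmetric] B_def[symmetric]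
          Suc_less_eq diff_Suc_Suc if_True times_divide_eq_right) (simp add: algebra_simps)
  next
    case False
    have "b ^ Suc n + u * gamma_sum l b (Suc n) = (b + u) * (b ^ n + l * u / (b + u) * gamma_sum l b n)"
      unfolding g using bu by (simp add: divide_simps) (simp add: algebra_simps)
    then show ?thesis using False bu by (simp add: f_general_def)
  qed
qed

text \<open>Passing from level \<open>n\<close> to \<open>Suc n\<close> adds the term
  \<open>j = 0\<close>, which is \<open>(a (Suc n) - a n) * ln (1 + u / b)\<close>, and the
  split-off logarithms, which add up to \<open>a n * ln (1 + u / b)\<close>. Together they carry the
  coefficient \<open>a (Suc n)\<close> of the recursion.\<close>

lemma sum_f_general_eq_iter_exponent:
  assumes "l > 0" "b > 0" "u \<ge> 0" "a 0 = 0"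
  shows "(\<Sum>j=0..n. f_general l b a n j u) = iter_exponent l b a n u"
  using assms(3)
proof (induction n arbitrary: u)
  case 0
  then show ?case by (simp add: f_general_def gamma_sum_def)
next
  case (Suc n)
  \<comment> \<open>The increments telescope to \<open>a n - a 0\<close>; here
    \<open>a 0 = 0\<close> enters.\<close>
  have tele: "(\<Sum>j=0..n. if j < n then (a (n - j) - a (n - j - 1)) * ln (1 + u / b) else 0) = a n * ln (1 + u / b)"
  proof -
    have "(\<Sum>j=0..n. if j < n then (a (n - j) - a (n - j - 1)) * ln (1 + u / b) else 0)
       = (\<Sum>j<n. (a (n - j) - a (n - Suc j)) * ln (1 + u / b))"
      by (rule sum.mono_neutral_cong_right) auto
    also have "\<dots> = (\<Sum>j<n. a (n - j) - a (n - Suc j)) * ln (1 + u / b)"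
      by (simp add: sum_distrib_right)
    also have "(\<Sum>j<n. a (n - j) - a (n - Suc j)) = a n"
      using sum_lessThan_telescope'[of "\<lambda>j. a (n - j)" n] assms by simp
    finally show ?thesis .
  qed
  have "(\<Sum>j=0..Suc n. f_general l b a (Suc n) j u) =
     f_general l b a (Suc n) 0 u + (\<Sum>j=0..n. f_general l b a (Suc n) (Suc j) u)"
    by (subst sum.atLeast0_atMost_Suc_shift) (simp add: o_def)
  also have "(\<Sum>j=0..n. f_general l b a (Suc n) (Suc j) u) =
     (\<Sum>j=0..n. f_general l b a n j (l * u / (b + u))) + a n * ln (1 + u / b)"
    using assms Suc by (simp add: f_general_Suc_Suc sum.distrib tele)
  also have "(\<Sum>j=0..n. f_general l b a n j (l * u / (b + u))) = iter_exponent l b a n (l * u / (b + u))"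
    using Suc assms by (intro Suc.IH) simp
  finally show ?case by (simp add: f_general_def gamma_sum_def algebra_simps)
qed

subsection \<open>Processes at independent random times\<close>

text \<open>Evaluating a path at a random time is not measurable on \<^const>\<open>path_space\<close>. For
  right-continuous paths it agrees with the following functional, which is jointly measurable
  since only countably many coordinates enter. The approximating times exceed \<open>T\<close> strictly.\<close>

definition path_eval :: "real \<Rightarrow> (real \<Rightarrow> real) \<Rightarrow> real" where
  "path_eval T x = lim (\<lambda>m. x (real (nat \<lfloor>real (Suc m) * T\<rfloor> + 1) / real (Suc m)))"

lemma measurable_path_component: "t \<ge> 0 \<Longrightarrow> (\<lambda>x. x t) \<in> borel_measurable path_space"
  unfolding path_space_def by (rule measurable_component_singleton) simp

lemma measurable_path_eval:
  "(\<lambda>z. path_eval (fst z) (snd z)) \<in> borel_measurable (borel \<Otimes>\<^sub>M path_space)"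
  unfolding path_eval_def
proof (rule borel_measurable_lim_metric)
  fix m
  show "(\<lambda>z. snd z (real (nat \<lfloor>real (Suc m) * fst z\<rfloor> + 1) / real (Suc m)))
    \<in> borel_measurable (borel \<Otimes>\<^sub>M path_space)"
  \<comment> \<open>The integer part takes countably many values, and for each fixed value
    \<open>i\<close> the path is read at a deterministic time.\<close>
  proof (rule measurable_compose_countable[where f="\<lambda>i z. snd z (real (i + 1) / real (Suc m))"
        and g="\<lambda>z. nat \<lfloor>real (Suc m) * fst z\<rfloor>"])
    show "(\<lambda>z. snd z (real (i + 1) / real (Suc m))) \<in> borel_measurable (borel \<Otimes>\<^sub>M path_space)" for i
      by (rule measurable_compose[OF measurable_snd measurable_path_component]) simp
  qed measurable
qed

lemma measurable_path_eval_compose: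
  assumes "T \<in> borel_measurable M" "Y \<in> measurable M path_space"
  shows "(\<lambda>x. path_eval (T x) (Y x)) \<in> borel_measurable M"
  using measurable_compose[OF measurable_Pair[OF assms] measurable_path_eval] by simp

lemma path_eval_sample_path:
  assumes "continuous (at_right T) (\<lambda>s. X s \<omega>)" "T \<ge> 0"
  shows "path_eval T (sample_path X \<omega>) = X T \<omega>"
proof -
  \<comment> \<open>\<open>d m\<close> is the least multiple of \<open>1 / Suc m\<close> strictly
    above \<open>T\<close>, so it approaches \<open>T\<close> from the right, the side on which
    continuity is assumed.\<close>
  define d where "d = (\<lambda>m. real (nat \<lfloor>real (Suc m) * T\<rfloor> + 1) / real (Suc m))"
  have floor_eq: "real (nat \<lfloor>real (Suc m) * T\<rfloor> + 1) = real_of_int \<lfloor>real (Suc m) * T\<rfloor> + 1" for m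
    using assms(2) by simp
  have d_gt: "d m > T" for m
  proof -
    have "real (Suc m) * T < real_of_int \<lfloor>real (Suc m) * T\<rfloor> + 1" by linarith
    then show ?thesis unfolding d_def floor_eq by (simp add: field_simps)
  qed
  have d_le: "d m \<le> T + 1 / real (Suc m)" for m
  proof -
    have "real_of_int \<lfloor>real (Suc m) * T\<rfloor> + 1 \<le> real (Suc m) * T + 1" by linarith
    then have "d m \<le> (real (Suc m) * T + 1) / real (Suc m)"
      unfolding d_def floor_eq by (rule divide_right_mono) simp
    then show ?thesis by (simp add: add_divide_distrib del: of_nat_Suc)
  qed
  have "d \<longlonglongrightarrow> T"
  proof (rule tendsto_sandwich[OF _ _ tendsto_const])
    have "(\<lambda>m. T + 1 / real (Suc m)) \<longlonglongrightarrow> T + 0"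
      by (intro tendsto_add tendsto_const LIMSEQ_Suc[OF lim_1_over_n])
    then show "(\<lambda>m. T + 1 / real (Suc m)) \<longlonglongrightarrow> T" by simp
  qed (use d_gt d_le in \<open>auto intro!: always_eventually less_imp_le\<close>)
  then have "filterlim d (at_right T) sequentially"
    using d_gt by (auto simp: filterlim_at intro!: always_eventually)
  moreover have "((\<lambda>s. X s \<omega>) \<longlongrightarrow> X T \<omega>) (at_right T)"
    using assms(1) by (simp add: continuous_within)
  ultimately have "(\<lambda>m. X (d m) \<omega>) \<longlonglongrightarrow> X T \<omega>"
    using filterlim_compose by fast
  moreover have "sample_path X \<omega> (d m) = X (d m) \<omega>" for m
    using d_gt[of m] assms(2) by (simp add: sample_path_def)
  ultimately show ?thesis
    unfolding path_eval_def d_def[symmetric, THEN fun_cong] by (simp add: limI flip: d_def)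
qed

context prob_space
begin

lemma subordinator_nonneg:
  assumes "subordinator Y" "t \<ge> 0" "\<omega> \<in> space M"
  shows "Y t \<omega> \<ge> 0"
proof -
  have "Y 0 \<omega> \<le> Y t \<omega>"
    using assms by (intro mono_onD[of "{0..}" "\<lambda>t. Y t \<omega>"]) (auto simp: subordinator_def)
  then show ?thesis using assms by (simp add: subordinator_def)
qed

lemma subordinator_path_eval:
  assumes "subordinator Y" "T \<ge> 0" "\<omega> \<in> space M"
  shows "path_eval T (sample_path Y \<omega>) = Y T \<omega>"
  using assms by (intro path_eval_sample_path) (auto simp: subordinator_def)

lemma subordinator_measurable_sample_path:
  assumes "subordinator Y"
  shows "sample_path Y \<in> measurable M path_space"
proof -
  have "(\<lambda>\<omega>. \<lambda>t\<in>{0..}. Y t \<omega>) \<in> measurable M (\<Pi>\<^sub>M t\<in>{0..}. borel)"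
    using assms by (intro measurable_restrict) (auto simp: subordinator_def)
  then show ?thesis by (simp add: path_space_def sample_path_def[abs_def])
qed

text \<open>Unlike \<^const>\<open>indep_var\<close>, this allows the two variables to have different value types.\<close>

definition indep_pair :: "'b measure \<Rightarrow> ('a \<Rightarrow> 'b) \<Rightarrow> 'c measure \<Rightarrow> ('a \<Rightarrow> 'c) \<Rightarrow> bool" where
  "indep_pair S X T Y \<longleftrightarrow> random_variable S X \<and> random_variable T Y \<and>
     distr M S X \<Otimes>\<^sub>M distr M T Y = distr M (S \<Otimes>\<^sub>M T) (\<lambda>\<omega>. (X \<omega>, Y \<omega>))"

text \<open>The product law of \<open>X\<close> and \<open>Y\<close> is pushed forward along the
  product map of \<open>F\<close> and \<open>G\<close>, which may change the value types.\<close>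

lemma indep_pair_compose:
  assumes ind: "indep_var S X T Y"
    and F[measurable]: "F \<in> measurable S S'" and G[measurable]: "G \<in> measurable T T'"
    and eq: "\<And>\<omega>. \<omega> \<in> space M \<Longrightarrow> X' \<omega> = F (X \<omega>)" "\<And>\<omega>. \<omega> \<in> space M \<Longrightarrow> Y' \<omega> = G (Y \<omega>)"
  shows "indep_pair S' X' T' Y'"
proof -
  have [measurable]: "random_variable S X" "random_variable T Y"
    and joint: "distr M S X \<Otimes>\<^sub>M distr M T Y = distr M (S \<Otimes>\<^sub>M T) (\<lambda>\<omega>. (X \<omega>, Y \<omega>))"
    using ind by (auto simp: indep_var_distribution_eq)
  have rv: "random_variable S' X'" "random_variable T' Y'"
    using eq by (simp_all cong: measurable_cong)
  interpret D: prob_space "distr M T' (\<lambda>\<omega>. G (Y \<omega>))" by (rule prob_space_distr) measurable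
  have "distr M S' X' \<Otimes>\<^sub>M distr M T' Y' = distr M S' (\<lambda>\<omega>. F (X \<omega>)) \<Otimes>\<^sub>M distr M T' (\<lambda>\<omega>. G (Y \<omega>))"
    using eq by (intro arg_cong2[where f="(\<Otimes>\<^sub>M)"] distr_cong) auto
  also have "\<dots> = distr (distr M S X) S' F \<Otimes>\<^sub>M distr (distr M T Y) T' G"
    by (simp add: distr_distr comp_def)
  also have "\<dots> = distr (distr M S X \<Otimes>\<^sub>M distr M T Y) (S' \<Otimes>\<^sub>M T') (\<lambda>(x, y). (F x, G y))"
    by (rule pair_measure_distr) (use D.sigma_finite_measure_axioms in \<open>simp_all add: distr_distr comp_def\<close>)
  also have "\<dots> = distr M (S' \<Otimes>\<^sub>M T') (\<lambda>\<omega>. (F (X \<omega>), G (Y \<omega>)))"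
    unfolding joint by (simp add: distr_distr comp_def)
  also have "\<dots> = distr M (S' \<Otimes>\<^sub>M T') (\<lambda>\<omega>. (X' \<omega>, Y' \<omega>))"
    using eq by (intro distr_cong) auto
  finally show ?thesis using rv by (simp add: indep_pair_def)
qed

lemma indep_pair_swap:
  assumes "indep_pair S X T Y"
  shows "indep_pair T Y S X"
proof -
  have rv[measurable]: "random_variable S X" "random_variable T Y"
    and joint: "distr M S X \<Otimes>\<^sub>M distr M T Y = distr M (S \<Otimes>\<^sub>M T) (\<lambda>\<omega>. (X \<omega>, Y \<omega>))"
    using assms by (auto simp: indep_pair_def)
  interpret DX: prob_space "distr M S X" by (rule prob_space_distr) fact
  interpret DY: prob_space "distr M T Y" by (rule prob_space_distr) fact
  interpret D: pair_prob_space "distr M T Y" "distr M S X" ..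
  have "distr M T Y \<Otimes>\<^sub>M distr M S X = 
    distr (distr M (S \<Otimes>\<^sub>M T) (\<lambda>\<omega>. (X \<omega>, Y \<omega>))) (distr M T Y \<Otimes>\<^sub>M distr M S X) (\<lambda>(x, y). (y, x))"
    using D.distr_pair_swap unfolding joint .
  also have "\<dots> = distr (distr M (S \<Otimes>\<^sub>M T) (\<lambda>\<omega>. (X \<omega>, Y \<omega>))) (T \<Otimes>\<^sub>M S) (\<lambda>(x, y). (y, x))"
    by (intro distr_cong refl sets_pair_measure_cong) auto
  also have "\<dots> = distr M (T \<Otimes>\<^sub>M S) (\<lambda>\<omega>. (Y \<omega>, X \<omega>))"
    by (subst distr_distr) (auto simp: comp_def)
  finally show ?thesis using rv by (simp add: indep_pair_def)
qed

lemma subordinator_at_random_time_measurable: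
  assumes "subordinator Y" "random_variable borel T" "\<And>\<omega>. \<omega> \<in> space M \<Longrightarrow> T \<omega> \<ge> 0"
  shows "random_variable borel (\<lambda>\<omega>. Y (T \<omega>) \<omega>)"
proof -
  have "random_variable borel (\<lambda>\<omega>. path_eval (T \<omega>) (sample_path Y \<omega>))"
    by (intro measurable_path_eval_compose assms subordinator_measurable_sample_path)
  moreover have "path_eval (T \<omega>) (sample_path Y \<omega>) = Y (T \<omega>) \<omega>" if "\<omega> \<in> space M" for \<omega>
    using that assms by (intro subordinator_path_eval) auto
  ultimately show ?thesis
    by (subst measurable_cong[where g="\<lambda>\<omega>. path_eval (T \<omega>) (sample_path Y \<omega>)"]) auto
qed

text \<open>Conditioning in the form of Fubini: time and path have a product law, and with the time
  frozen at \<open>s\<close> the integral over paths is \<open>h s\<close>.\<close>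

lemma expectation_at_independent_time:
  fixes g h :: "real \<Rightarrow> real"
  assumes Y: "subordinator Y" and ind: "indep_pair borel T path_space (sample_path Y)"
    and T: "\<And>\<omega>. \<omega> \<in> space M \<Longrightarrow> T \<omega> \<ge> 0"
    and g[measurable]: "g \<in> borel_measurable borel" and bdd: "\<And>x. \<bar>g x\<bar> \<le> 1"
    and h: "\<And>s. s \<ge> 0 \<Longrightarrow> expectation (\<lambda>\<omega>. g (Y s \<omega>)) = h s"
  shows "expectation (\<lambda>\<omega>. g (Y (T \<omega>) \<omega>)) = expectation (\<lambda>\<omega>. h (T \<omega>))"
proof -
  note [measurable] = measurable_path_eval
  have rvT[measurable]: "random_variable borel T"
    and rvY[measurable]: "random_variable path_space (sample_path Y)"
    and joint: "distr M borel T \<Otimes>\<^sub>M distr M path_space (sample_path Y) =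
      distr M (borel \<Otimes>\<^sub>M path_space) (\<lambda>\<omega>. (T \<omega>, sample_path Y \<omega>))"
    using ind by (auto simp: indep_pair_def)
  interpret D1: prob_space "distr M borel T" by (rule prob_space_distr) fact
  interpret D2: prob_space "distr M path_space (sample_path Y)" by (rule prob_space_distr) fact
  interpret D: pair_prob_space "distr M borel T" "distr M path_space (sample_path Y)" ..
  let ?G = "\<lambda>z. g (path_eval (fst z) (snd z))"
  have G[measurable]: "?G \<in> borel_measurable (borel \<Otimes>\<^sub>M path_space)" by measurable
  have "expectation (\<lambda>\<omega>. g (Y (T \<omega>) \<omega>)) = expectation (\<lambda>\<omega>. ?G (T \<omega>, sample_path Y \<omega>))"
    using T by (intro Bochner_Integration.integral_cong) (auto simp: subordinator_path_eval[OF Y])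
  also have "\<dots> = (\<integral>z. ?G z \<partial>(distr M borel T \<Otimes>\<^sub>M distr M path_space (sample_path Y)))"
    unfolding joint by (rule integral_distr[symmetric]) measurable
  also have "\<dots> = (\<integral>s. \<integral>y. ?G (s, y) \<partial>distr M path_space (sample_path Y) \<partial>distr M borel T)"
  proof (rule D.integral_fst'[symmetric])
    have "?G \<in> borel_measurable (distr M borel T \<Otimes>\<^sub>M distr M path_space (sample_path Y))"
      using G by (simp cong: measurable_cong_sets)
    then show "integrable (distr M borel T \<Otimes>\<^sub>M distr M path_space (sample_path Y)) ?G"
      by (rule D.integrable_const_bound[where B=1, rotated]) (simp add: bdd)
  qed
  also have "\<dots> = expectation (\<lambda>\<omega>. \<integral>y. ?G (T \<omega>, y) \<partial>distr M path_space (sample_path Y))"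
  proof (rule integral_distr)
    show "(\<lambda>s. \<integral>y. ?G (s, y) \<partial>distr M path_space (sample_path Y)) \<in> borel_measurable borel"
      by (rule D2.borel_measurable_lebesgue_integral) (use G in \<open>simp add: case_prod_beta' cong: measurable_cong_sets\<close>)
  qed measurable
  also have "\<dots> = expectation (\<lambda>\<omega>. h (T \<omega>))"
  proof (rule Bochner_Integration.integral_cong[OF refl])
    fix \<omega> assume \<omega>: "\<omega> \<in> space M"
    \<comment> \<open>Here \<open>\<omega>\<close> only fixes the time; the path is averaged over a
      separate sample point \<open>\<omega>'\<close>.\<close>
    have "(\<integral>y. ?G (T \<omega>, y) \<partial>distr M path_space (sample_path Y)) =
      expectation (\<lambda>\<omega>'. ?G (T \<omega>, sample_path Y \<omega>'))"
      by (rule integral_distr[OF rvY]) (rule measurable_compose[OF measurable_Pair1' G], simp)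
    also have "\<dots> = expectation (\<lambda>\<omega>'. g (Y (T \<omega>) \<omega>'))"
      using T[OF \<omega>] by (intro Bochner_Integration.integral_cong) (auto simp: subordinator_path_eval[OF Y])
    finally show "(\<integral>y. ?G (T \<omega>, y) \<partial>distr M path_space (sample_path Y)) = h (T \<omega>)"
      using h T[OF \<omega>] by simp
  qed
  finally show ?thesis .
qed

section \<open>Generating functions and Laplace transforms at random times\<close>

lemma sums_expectation_power:
  fixes K :: "'a \<Rightarrow> nat" and z :: real
  assumes [measurable]: "K \<in> measurable M (count_space UNIV)" and z: "\<bar>z\<bar> < 1"
  shows "(\<lambda>k. prob {\<omega>\<in>space M. K \<omega> = k} * z ^ k) sums expectation (\<lambda>\<omega>. z ^ K \<omega>)"
proof -
  let ?f = "\<lambda>k \<omega>. indicator {\<omega>\<in>space M. K \<omega> = k} \<omega> * z ^ k"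
  have int: "integrable M (?f k)" for k
    by (intro integrable_mult_left) (simp add: emeasure_eq_measure)
  have fin: "finite {k. ?f k \<omega> \<noteq> 0}" for \<omega>
    by (rule finite_subset[of _ "{K \<omega>}"]) (auto simp: indicator_def)
  have "(\<lambda>k. integral\<^sup>L M (?f k)) sums (\<integral>\<omega>. (\<Sum>k. ?f k \<omega>) \<partial>M)"
  proof (rule sums_integral[OF int])
    show "AE \<omega> in M. summable (\<lambda>k. norm (?f k \<omega>))"
      using fin by (intro AE_I2 summable_finite[of "{k. ?f k _ \<noteq> 0}"]) auto
    have "norm (?f k \<omega>) = indicator {\<omega>\<in>space M. K \<omega> = k} \<omega> * \<bar>z\<bar> ^ k" for k \<omega>
      by (simp add: abs_mult power_abs indicator_def)
    then have "(\<integral>\<omega>. norm (?f k \<omega>) \<partial>M) = prob {\<omega>\<in>space M. K \<omega> = k} * \<bar>z\<bar> ^ k" for k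
      by simp
    \<comment> \<open>Comparison with the geometric series in \<open>\<bar>z\<bar>\<close> justifies
      exchanging sum and expectation.\<close>
    then show "summable (\<lambda>k. \<integral>\<omega>. norm (?f k \<omega>) \<partial>M)"
      using z by (auto intro!: summable_comparison_test'[OF summable_geometric[of "\<bar>z\<bar>"], of 0] mult_left_le_one_le)
  qed
  moreover have "(\<Sum>k. ?f k \<omega>) = z ^ K \<omega>" if "\<omega> \<in> space M" for \<omega>
    by (subst suminf_finite[of "{K \<omega>}"]) (use that in auto)
  ultimately show ?thesis
    by (simp cong: Bochner_Integration.integral_cong)
qed

text \<open>The subordinator property speaks of the real-valued copy of the process; the floor
  recovers the natural number measurably.\<close>

lemma poisson_process_measurable:
  assumes "poisson_process r N" "t \<ge> 0"
  shows "N t \<in> measurable M (count_space UNIV)"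
proof -
  have "random_variable borel (\<lambda>\<omega>. real (N t \<omega>))"
    using assms by (auto simp: poisson_process_def subordinator_def)
  then have "(\<lambda>\<omega>. nat \<lfloor>real (N t \<omega>)\<rfloor>) \<in> measurable M (count_space UNIV)"
    by measurable
  then show ?thesis by simp
qed

lemma poisson_process_pgf:
  fixes z :: real
  assumes N: "poisson_process r N" and "r > 0" "t \<ge> 0" and z: "\<bar>z\<bar> < 1"
  shows "expectation (\<lambda>\<omega>. z ^ N t \<omega>) = exp (- (r * (1 - z)) * t)"
proof (cases "t = 0")
  case True
  have "N t \<omega> = 0" if "\<omega> \<in> space M" for \<omega>
    using N that True by (simp add: poisson_process_def subordinator_def)
  then have "expectation (\<lambda>\<omega>. z ^ N t \<omega>) = expectation (\<lambda>_. 1)"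
    by (intro Bochner_Integration.integral_cong) auto
  then show ?thesis using True by (simp add: prob_space)
next
  case False
  then have "t > 0" using assms by simp
  note [measurable] = poisson_process_measurable[OF N \<open>t \<ge> 0\<close>]
  have "prob {\<omega>\<in>space M. N t \<omega> = k} = (r * t) ^ k / fact k * exp (- (r * t))" for k
  proof -
    have "prob {\<omega>\<in>space M. N t \<omega> = k} = measure (distr M (count_space UNIV) (N t)) {k}"
      by (subst measure_distr) (auto intro!: arg_cong[where f=prob])
    also have "distr M (count_space UNIV) (N t) = measure_pmf (poisson_pmf (r * t))"
      using N \<open>t > 0\<close> by (simp add: poisson_process_def)
    also have "measure \<dots> {k} = (r * t) ^ k / fact k * exp (- (r * t))"
      using \<open>t > 0\<close> \<open>r > 0\<close> by (simp add: measure_pmf_single)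
    finally show ?thesis .
  qed
  with sums_expectation_power[of "N t" z] z
  have "(\<lambda>k. (r * t) ^ k / fact k * exp (- (r * t)) * z ^ k) sums expectation (\<lambda>\<omega>. z ^ N t \<omega>)"
    by simp
  moreover have "(\<lambda>k. (r * t) ^ k / fact k * exp (- (r * t)) * z ^ k) sums (exp (r * t * z) * exp (- (r * t)))"
    using sums_mult2[OF exp_converges[of "r * t * z"], of "exp (- (r * t))"]
    by (simp add: power_mult_distrib field_simps)
  ultimately have "expectation (\<lambda>\<omega>. z ^ N t \<omega>) = exp (r * t * z) * exp (- (r * t))"
    by (rule sums_unique2)
  then show ?thesis by (simp add: exp_add[symmetric] algebra_simps)
qed

lemma poisson_process_pgf_at_independent_time:
  fixes z :: real
  assumes N: "poisson_process r N" and "r > 0" and z: "\<bar>z\<bar> < 1"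
    and ind: "indep_pair borel T path_space (sample_path (\<lambda>t \<omega>. real (N t \<omega>)))"
    and T: "\<And>\<omega>. \<omega> \<in> space M \<Longrightarrow> T \<omega> \<ge> 0"
  shows "expectation (\<lambda>\<omega>. z ^ N (T \<omega>) \<omega>) = expectation (\<lambda>\<omega>. exp (- (r * (1 - z)) * T \<omega>))"
proof -
  \<comment> \<open>The test function must live on all reals, so the exponent is a floor, which is
    exact on the values of \<open>N\<close>.\<close>
  have "expectation (\<lambda>\<omega>. z ^ nat \<lfloor>real (N (T \<omega>) \<omega>)\<rfloor>) = expectation (\<lambda>\<omega>. exp (- (r * (1 - z)) * T \<omega>))"
  proof (rule expectation_at_independent_time[OF _ ind T, where g="\<lambda>x. z ^ nat \<lfloor>x\<rfloor>"])
    show "subordinator (\<lambda>t \<omega>. real (N t \<omega>))" using N by (simp add: poisson_process_def)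
    show "\<bar>z ^ nat \<lfloor>x\<rfloor>\<bar> \<le> 1" for x using z by (simp add: power_abs power_le_one)
  qed (use poisson_process_pgf[OF N \<open>r > 0\<close> _ z] in simp_all)
  then show ?thesis by simp
qed

lemma laplace_at_independent_time:
  assumes Y: "subordinator Y" "has_laplace_exponent Y \<phi>"
    and ind: "indep_pair borel T path_space (sample_path Y)"
    and T: "\<And>\<omega>. \<omega> \<in> space M \<Longrightarrow> T \<omega> \<ge> 0" and u: "u \<ge> 0"
  shows "expectation (\<lambda>\<omega>. exp (- u * Y (T \<omega>) \<omega>)) = expectation (\<lambda>\<omega>. exp (- T \<omega> * \<phi> u))"
proof -
  \<comment> \<open>Truncation at 0 bounds the test function by 1 on the whole line and does not
    affect the nonnegative values of \<open>Y\<close>.\<close>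
  have pos: "max 0 (Y s \<omega>) = Y s \<omega>" if "s \<ge> 0" "\<omega> \<in> space M" for s \<omega>
    using subordinator_nonneg[OF Y(1) that] by simp
  have "expectation (\<lambda>\<omega>. exp (- u * max 0 (Y (T \<omega>) \<omega>))) = expectation (\<lambda>\<omega>. exp (- T \<omega> * \<phi> u))"
  proof (rule expectation_at_independent_time[OF Y(1) ind T, where g="\<lambda>x. exp (- u * max 0 x)"])
    show "\<bar>exp (- u * max 0 x)\<bar> \<le> 1" for x using u by simp
    show "expectation (\<lambda>\<omega>. exp (- u * max 0 (Y s \<omega>))) = exp (- s * \<phi> u)" if "s \<ge> 0" for s
    proof -
      have "expectation (\<lambda>\<omega>. exp (- u * max 0 (Y s \<omega>))) = expectation (\<lambda>\<omega>. exp (- u * Y s \<omega>))"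
        using pos that by (intro Bochner_Integration.integral_cong) auto
      then show ?thesis using Y(2) u that by (simp add: has_laplace_exponent_def)
    qed
  qed simp_all
  moreover have "expectation (\<lambda>\<omega>. exp (- u * max 0 (Y (T \<omega>) \<omega>))) = expectation (\<lambda>\<omega>. exp (- u * Y (T \<omega>) \<omega>))"
    using pos T by (intro Bochner_Integration.integral_cong) auto
  ultimately show ?thesis by simp
qed

end

subsection \<open>The iterated process\<close>

context prob_space
begin

text \<open>A concrete substitute for measurability with respect to the sigma-algebra generated by
  the paths indexed by \<open>A\<close>. It is stable under the operations that build the iterates,
  and disjoint index sets turn into independence.\<close>

definition path_functional ::
  "('i \<Rightarrow> 'a \<Rightarrow> real \<Rightarrow> real) \<Rightarrow> 'i set \<Rightarrow> ('a \<Rightarrow> real) \<Rightarrow> bool" where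
  "path_functional Z A T \<longleftrightarrow>
     (\<exists>F\<in>borel_measurable (\<Pi>\<^sub>M i\<in>A. path_space). \<forall>\<omega>\<in>space M. T \<omega> = F (\<lambda>i\<in>A. Z i \<omega>))"

lemma path_functional_const: "path_functional Z A (\<lambda>_. c)"
  unfolding path_functional_def by (intro bexI[of _ "\<lambda>_. c"]) auto

lemma path_functional_affine:
  assumes "path_functional Z A T"
  shows "path_functional Z A (\<lambda>\<omega>. c + T \<omega>)"
proof -
  obtain F where "F \<in> borel_measurable (\<Pi>\<^sub>M i\<in>A. path_space)"
    "\<forall>\<omega>\<in>space M. T \<omega> = F (\<lambda>i\<in>A. Z i \<omega>)"
    using assms by (auto simp: path_functional_def)
  then show ?thesis unfolding path_functional_def
    by (intro bexI[of _ "\<lambda>x. c + F x"]) auto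
qed

lemma path_functional_mono:
  assumes "path_functional Z A T" "A \<subseteq> B"
  shows "path_functional Z B T"
proof -
  obtain F where F: "F \<in> borel_measurable (\<Pi>\<^sub>M i\<in>A. path_space)"
    "\<forall>\<omega>\<in>space M. T \<omega> = F (\<lambda>i\<in>A. Z i \<omega>)"
    using assms by (auto simp: path_functional_def)
  have "(\<lambda>x. F (restrict x A)) \<in> borel_measurable (\<Pi>\<^sub>M i\<in>B. path_space)"
    by (rule measurable_compose[OF measurable_restrict_subset[OF assms(2)] F(1)])
  moreover have "restrict (\<lambda>i\<in>B. Z i \<omega>) A = (\<lambda>i\<in>A. Z i \<omega>)" for \<omega>
    using assms(2) by (intro ext) (auto simp: restrict_def)
  ultimately show ?thesis unfolding path_functional_def
    using F(2) by (intro bexI[of _ "\<lambda>x. F (restrict x A)"]) auto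
qed

text \<open>This rests on joint measurability of \<open>path_eval\<close>; the path that is
  evaluated may already enter into \<open>T\<close>.\<close>

lemma path_functional_at_time:
  assumes "path_functional Z A T" "i \<in> A" "Z i = sample_path Y" "subordinator Y"
    and T: "\<And>\<omega>. \<omega> \<in> space M \<Longrightarrow> T \<omega> \<ge> 0"
  shows "path_functional Z A (\<lambda>\<omega>. Y (T \<omega>) \<omega>)"
proof -
  obtain F where F: "F \<in> borel_measurable (\<Pi>\<^sub>M i\<in>A. path_space)"
    "\<forall>\<omega>\<in>space M. T \<omega> = F (\<lambda>i\<in>A. Z i \<omega>)"
    using assms by (auto simp: path_functional_def)
  have "(\<lambda>x. path_eval (F x) (x i)) \<in> borel_measurable (\<Pi>\<^sub>M i\<in>A. path_space)"
    by (intro measurable_path_eval_compose F measurable_component_singleton assms)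
  moreover have "Y (T \<omega>) \<omega> = path_eval (F (\<lambda>i\<in>A. Z i \<omega>)) ((\<lambda>i\<in>A. Z i \<omega>) i)"
    if "\<omega> \<in> space M" for \<omega>
    using subordinator_path_eval[OF assms(4) T[OF that] that] F(2) that assms(2,3) by simp
  ultimately show ?thesis unfolding path_functional_def
    by (intro bexI[of _ "\<lambda>x. path_eval (F x) (x i)"]) auto
qed

text \<open>Disjoint blocks of an independent family are independent, here the blocks
  \<open>A\<close> and \<open>{i}\<close>.\<close>

lemma path_functional_indep_pair:
  assumes ind: "indep_vars (\<lambda>_. path_space) Z I" and "path_functional Z A T"
    and "A \<subseteq> I" "i \<in> I" "i \<notin> A"
  shows "indep_pair borel T path_space (Z i)"
proof -
  obtain F where F: "F \<in> borel_measurable (\<Pi>\<^sub>M i\<in>A. path_space)"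
    "\<forall>\<omega>\<in>space M. T \<omega> = F (\<lambda>i\<in>A. Z i \<omega>)"
    using assms by (auto simp: path_functional_def)
  have "(\<lambda>x. x i) \<in> measurable (\<Pi>\<^sub>M j\<in>{i}. path_space) path_space"
    by (rule measurable_component_singleton) simp
  from indep_pair_compose[OF indep_var_restrict[OF ind, of A "{i}"] F(1) this, of T "Z i"]
  show ?thesis using assms F(2) by auto
qed

end

section \<open>The iterated process with common parameters at all stages\<close>

locale iterated_process = prob_space M for M :: "'a measure" +
  fixes n :: nat and b l :: real and a :: "nat \<Rightarrow> real"
    and E :: "nat \<Rightarrow> real \<Rightarrow> 'a \<Rightarrow> real" and N :: "nat \<Rightarrow> real \<Rightarrow> 'a \<Rightarrow> nat"
  assumes pos: "b > 0" "l > 0"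
    and a_nonneg: "i \<in> {1..n} \<Longrightarrow> a i \<ge> 0"
    and E: "i \<in> {1..n} \<Longrightarrow> exponential_process b (E i)"
    and N: "i \<in> {1..n} \<Longrightarrow> poisson_process l (N i)"
    and indep: "indep_vars (\<lambda>_. path_space)
           (case_sum (\<lambda>i. sample_path (E i)) (\<lambda>i. sample_path (\<lambda>t \<omega>. real (N i t \<omega>))))
           ({1..n} <+> {1..n})"
begin

abbreviation X :: "nat \<Rightarrow> real \<Rightarrow> 'a \<Rightarrow> real" where
  "X \<equiv> iter_process a E N"

abbreviation Z :: "nat + nat \<Rightarrow> 'a \<Rightarrow> real \<Rightarrow> real" where
  "Z \<equiv> case_sum (\<lambda>i. sample_path (E i)) (\<lambda>i. sample_path (\<lambda>t \<omega>. real (N i t \<omega>)))"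

lemma subordinator_E: "i \<in> {1..n} \<Longrightarrow> subordinator (E i)"
  and laplace_E: "i \<in> {1..n} \<Longrightarrow> has_laplace_exponent (E i) (\<lambda>u. ln (1 + u / b))"
  using E by (simp_all add: exponential_process_def)

lemma subordinator_N: "i \<in> {1..n} \<Longrightarrow> subordinator (\<lambda>t \<omega>. real (N i t \<omega>))"
  using N by (simp add: poisson_process_def)

lemma X_nonneg:
  assumes "i \<le> n" "t \<ge> 0" "\<omega> \<in> space M"
  shows "X i t \<omega> \<ge> 0"
proof (cases i)
  case (Suc j)
  then have "i \<in> {1..n}" using assms by simp
  then have "E i (a i * t + real (N i (X j t \<omega>) \<omega>)) \<omega> \<ge> 0"
    using assms a_nonneg by (intro subordinator_nonneg[OF subordinator_E]) auto
  then show ?thesis using Suc by simp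
qed (use assms in simp)

lemma X_at_0:
  assumes "i \<le> n" "\<omega> \<in> space M"
  shows "X i 0 \<omega> = 0"
  using assms(1)
proof (induction i)
  case (Suc i)
  then show ?case using subordinator_E[of "Suc i"] subordinator_N[of "Suc i"] assms(2)
    by (simp add: subordinator_def)
qed simp

text \<open>This bookkeeping of indices is what makes the processes of stage \<open>Suc i\<close>
  independent of the iterate \<open>X i t\<close>.\<close>

lemma path_functional_X:
  assumes "i \<le> n" "t \<ge> 0"
  shows "path_functional Z ({1..i} <+> {1..i}) (X i t)"
  using assms(1)
proof (induction i)
  case 0
  then show ?case by (simp add: path_functional_const)
next
  case (Suc i)
  let ?A = "{1..Suc i} <+> {1..Suc i}"
  have mem: "Suc i \<in> {1..n}" using Suc by simp
  have "path_functional Z ?A (X i t)"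
    by (rule path_functional_mono[OF Suc.IH]) (use Suc in auto)
  then have "path_functional Z ?A (\<lambda>\<omega>. real (N (Suc i) (X i t \<omega>) \<omega>))"
    by (rule path_functional_at_time[where i="Inr (Suc i)" and Y="\<lambda>t \<omega>. real (N (Suc i) t \<omega>)"])
      (use Suc assms mem subordinator_N X_nonneg in auto)
  then have "path_functional Z ?A (\<lambda>\<omega>. a (Suc i) * t + real (N (Suc i) (X i t \<omega>) \<omega>))"
    by (rule path_functional_affine)
  then have "path_functional Z ?A (\<lambda>\<omega>. E (Suc i) (a (Suc i) * t + real (N (Suc i) (X i t \<omega>) \<omega>)) \<omega>)"
    by (rule path_functional_at_time[where i="Inl (Suc i)" and Y="E (Suc i)"])
      (use Suc assms mem subordinator_E a_nonneg in auto)
  then show ?case by simp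
qed

text \<open>Two conditionings, from the outside inward: on the time argument of
  \<open>E (Suc i)\<close>, then on the time \<open>X i t\<close> of the Poisson process. The
  variable \<open>u\<close> is kept general because the inner stage is needed at
  \<open>l * u / (b + u)\<close>.\<close>

lemma laplace_X:
  assumes "i \<le> n" "t \<ge> 0" "u \<ge> 0"
  shows "expectation (\<lambda>\<omega>. exp (- u * X i t \<omega>)) = exp (- t * iter_exponent l b a i u)"
  using assms(1,3)
proof (induction i arbitrary: u)
  case 0
  then show ?case by (simp add: prob_space)
next
  case (Suc i)
  \<comment> \<open>\<open>?B\<close> includes the Poisson path of the new stage but not its
    exponential path: the time \<open>?S\<close> depends on the former and must be independent of
    the latter.\<close>
  let ?A = "{1..i} <+> {1..i}" and ?B = "{1..i} <+> {1..Suc i}"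
  let ?S = "\<lambda>\<omega>. a (Suc i) * t + real (N (Suc i) (X i t \<omega>) \<omega>)"
  have mem: "Suc i \<in> {1..n}" and i: "i \<le> n" using Suc by simp_all
  have Xi: "path_functional Z ?A (X i t)"
    by (rule path_functional_X[OF i assms(2)])
  have "path_functional Z ?B (X i t)"
    by (rule path_functional_mono[OF Xi]) auto
  then have "path_functional Z ?B (\<lambda>\<omega>. real (N (Suc i) (X i t \<omega>) \<omega>))"
    by (rule path_functional_at_time[where i="Inr (Suc i)" and Y="\<lambda>t \<omega>. real (N (Suc i) t \<omega>)"])
      (use i assms mem subordinator_N X_nonneg in auto)
  then have S: "path_functional Z ?B ?S"
    by (rule path_functional_affine)
  have indE: "indep_pair borel ?S path_space (sample_path (E (Suc i)))"
  proof -
    have "?B \<subseteq> {1..n} <+> {1..n}" "Inl (Suc i) \<in> {1..n} <+> {1..n}" "Inl (Suc i) \<notin> ?B"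
      using mem by auto
    from path_functional_indep_pair[OF indep S this] show ?thesis by simp
  qed
  have indN: "indep_pair borel (X i t) path_space (sample_path (\<lambda>t \<omega>. real (N (Suc i) t \<omega>)))"
  proof -
    have "?A \<subseteq> {1..n} <+> {1..n}" "Inr (Suc i) \<in> {1..n} <+> {1..n}" "Inr (Suc i) \<notin> ?A"
      using mem by auto
    from path_functional_indep_pair[OF indep Xi this] show ?thesis by simp
  qed
  \<comment> \<open>Each unit of time of \<open>E (Suc i)\<close> contributes the factor
    \<open>exp (- c) = z\<close>, so the Poisson count appears as an exponent of
    \<open>z\<close>.\<close>
  define z where "z = b / (b + u)"
  define c where "c = ln (1 + u / b)"
  have z: "exp (- c) = z" "l * (1 - z) = l * u / (b + u)"
  proof -
    have "b + u > 0" "1 + u / b > 0" using pos Suc.prems by (simp_all add: add_pos_nonneg)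
    then show "exp (- c) = z" "l * (1 - z) = l * u / (b + u)"
      using pos by (simp_all add: z_def c_def exp_minus divide_simps)
  qed
  have "expectation (\<lambda>\<omega>. exp (- u * X (Suc i) t \<omega>)) = expectation (\<lambda>\<omega>. exp (- ?S \<omega> * c))"
    using laplace_at_independent_time[OF subordinator_E[OF mem] laplace_E[OF mem] indE] mem a_nonneg
      assms(2) Suc.prems by (simp add: c_def)
  also have "\<dots> = expectation (\<lambda>\<omega>. exp (- (a (Suc i) * t * c)) * z ^ N (Suc i) (X i t \<omega>) \<omega>)"
  proof (rule Bochner_Integration.integral_cong[OF refl])
    fix \<omega>
    have "exp (- ?S \<omega> * c) = exp (- (a (Suc i) * t * c)) * exp (real (N (Suc i) (X i t \<omega>) \<omega>) * - c)"
      by (subst exp_add[symmetric]) (simp add: algebra_simps)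
    then show "exp (- ?S \<omega> * c) = exp (- (a (Suc i) * t * c)) * z ^ N (Suc i) (X i t \<omega>) \<omega>"
      by (simp only: exp_of_nat_mult z(1))
  qed
  also have "\<dots> = exp (- (a (Suc i) * t * c)) * expectation (\<lambda>\<omega>. z ^ N (Suc i) (X i t \<omega>) \<omega>)"
    by simp
  also have "expectation (\<lambda>\<omega>. z ^ N (Suc i) (X i t \<omega>) \<omega>) = exp (- t * iter_exponent l b a i (l * u / (b + u)))"
  \<comment> \<open>For \<open>u = 0\<close> one has \<open>z = 1\<close>, outside the open interval
    on which the generating function is available; the induction hypothesis at 0 covers it.\<close>
  proof (cases "u = 0")
    case True
    then have "z = 1" using pos by (simp add: z_def)
    have "expectation (\<lambda>\<omega>. exp (- 0 * X i t \<omega>)) = exp (- t * iter_exponent l b a i 0)"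
      by (rule Suc.IH[OF i]) simp
    then show ?thesis using True \<open>z = 1\<close> by simp
  next
    case False
    then have "\<bar>z\<bar> < 1" using pos Suc.prems by (simp add: z_def)
    then have "expectation (\<lambda>\<omega>. z ^ N (Suc i) (X i t \<omega>) \<omega>) = expectation (\<lambda>\<omega>. exp (- (l * (1 - z)) * X i t \<omega>))"
      using poisson_process_pgf_at_independent_time[OF N[OF mem] pos(2) _ indN] X_nonneg[OF i assms(2)]
      by simp
    also have "\<dots> = exp (- t * iter_exponent l b a i (l * u / (b + u)))"
      unfolding z(2) by (rule Suc.IH[OF i]) (use pos Suc.prems in simp)
    finally show ?thesis .
  qed
  finally show ?case
    by (simp add: c_def exp_add[symmetric] algebra_simps)
qed

lemma solves_shift_equation_f_general:
  fixes N\<^sub>\<mu> :: "real \<Rightarrow> 'a \<Rightarrow> nat"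
  assumes "a 0 = 0" and "\<mu> > 0" and P: "poisson_process \<mu> N\<^sub>\<mu>"
    and ind: "indep_var path_space (sample_path (\<lambda>t \<omega>. real (N\<^sub>\<mu> t \<omega>))) path_space (sample_path (X n))"
  shows "solves_shift_equation n (f_general l b a n) \<mu>
    (\<lambda>k t. prob {\<omega> \<in> space M. N\<^sub>\<mu> (X n t \<omega>) \<omega> = k})"
proof -
  define p where "p = (\<lambda>k t. prob {\<omega> \<in> space M. N\<^sub>\<mu> (X n t \<omega>) \<omega> = k})"
  define C where "C = (\<Sum>j=0..n. shift_fps (f_general l b a n j) \<mu>)"
  define F where "F = (\<lambda>z. \<Sum>j=0..n. f_general l b a n j (\<mu> * (1 - z)))"
  have sub: "subordinator (\<lambda>t \<omega>. real (N\<^sub>\<mu> t \<omega>))"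
    using P by (simp add: poisson_process_def)
  have F: "F has_fps_expansion C"
    unfolding F_def C_def
    by (intro has_fps_expansion_sum f_general_has_fps_expansion pos assms(2))
  have pgf: "(\<lambda>k. p k t * z ^ k) sums exp (- t * F z)" if t: "t \<ge> 0" and z: "\<bar>z\<bar> < 1" for t z
  proof -
    \<comment> \<open>Independence from the whole path of \<open>X n\<close> passes to time
      \<open>t\<close> by projecting to a coordinate; the swap puts the random time first.\<close>
    have indt: "indep_pair borel (X n t) path_space (sample_path (\<lambda>t \<omega>. real (N\<^sub>\<mu> t \<omega>)))"
      by (rule indep_pair_swap, rule indep_pair_compose[OF ind measurable_ident measurable_path_component[OF t]])
        (use t in \<open>simp_all add: sample_path_def\<close>)
    then have "random_variable borel (X n t)" by (simp add: indep_pair_def)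
    then have "random_variable borel (\<lambda>\<omega>. real (N\<^sub>\<mu> (X n t \<omega>) \<omega>))"
      using X_nonneg t by (intro subordinator_at_random_time_measurable[OF sub]) auto
    then have "(\<lambda>\<omega>. nat \<lfloor>real (N\<^sub>\<mu> (X n t \<omega>) \<omega>)\<rfloor>) \<in> measurable M (count_space UNIV)"
      by measurable
    then have "(\<lambda>k. p k t * z ^ k) sums expectation (\<lambda>\<omega>. z ^ N\<^sub>\<mu> (X n t \<omega>) \<omega>)"
      using sums_expectation_power[of "\<lambda>\<omega>. N\<^sub>\<mu> (X n t \<omega>) \<omega>" z] z by (simp add: p_def)
    also have "expectation (\<lambda>\<omega>. z ^ N\<^sub>\<mu> (X n t \<omega>) \<omega>) = expectation (\<lambda>\<omega>. exp (- (\<mu> * (1 - z)) * X n t \<omega>))"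
      using X_nonneg t by (intro poisson_process_pgf_at_independent_time[OF P assms(2) z indt]) auto
    \<comment> \<open>For all \<open>\<bar>z\<bar> < 1\<close>, negative \<open>z\<close> included,
      \<open>\<mu> * (1 - z)\<close> is nonnegative, so a full neighbourhood of 0 is
      covered.\<close>
    also have "\<dots> = exp (- t * iter_exponent l b a n (\<mu> * (1 - z)))"
      using t z assms(2) by (intro laplace_X) auto
    also have "iter_exponent l b a n (\<mu> * (1 - z)) = F z"
      unfolding F_def using z assms pos by (intro sum_f_general_eq_iter_exponent[symmetric]) auto
    finally show ?thesis .
  qed
  have near: "eventually (\<lambda>z::real. \<bar>z\<bar> < 1) (nhds 0)"
    by (rule eventually_nhds_metric[THEN iffD2]) (auto intro!: exI[of _ 1])
  define G where "G = (\<lambda>t z. exp (- t * F z))"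
  have G: "G t has_fps_expansion Abs_fps (\<lambda>k. p k t)" if "t > 0" for t
    by (rule has_fps_expansionI, rule eventually_mono[OF near]) (use pgf that in \<open>simp add: G_def\<close>)
  have ode: "fps_nth (Abs_fps (\<lambda>k. p k t)) 0 = exp (- t * fps_nth C 0)"
    "fps_deriv (Abs_fps (\<lambda>k. p k t)) = fps_const (- t) * (fps_deriv C * Abs_fps (\<lambda>k. p k t))"
    if "t > 0" for t
    by (rule fps_expansion_exp_ode[OF F G[OF that]]; simp add: G_def)+
  \<comment> \<open>\<open>C\<close> is the sum of the individual shift series, so the Cauchy
    product with \<open>C\<close> distributes into the sum of the shift operators.\<close>
  have "((\<lambda>s. p k s) has_real_derivative
        - (\<Sum>j=0..n. fun_of_shift (f_general l b a n j) \<mu> (\<lambda>i. p i t) k)) (at t)"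
    if "t > 0" for k t
    using fps_exp_flow[of "\<lambda>s. Abs_fps (\<lambda>k. p k s)" C t k, OF ode that]
    by (simp add: C_def fun_of_shift_eq_fps_mult sum_distrib_right fps_sum_nth)
  \<comment> \<open>At time 0 every path of \<open>X n\<close>, and then of
    \<open>N\<^sub>\<mu>\<close>, is at 0, so the event is all of \<open>space M\<close> or
    empty.\<close>
  moreover have "p k 0 = (if k = 0 then 1 else 0)" for k
  proof -
    have "{\<omega> \<in> space M. N\<^sub>\<mu> (X n 0 \<omega>) \<omega> = k} = (if k = 0 then space M else {})"
      using sub X_at_0[of n] by (auto simp: subordinator_def)
    then show ?thesis by (simp add: p_def prob_space)
  qed
  ultimately show ?thesis
    unfolding solves_shift_equation_def p_def by auto
qed

end

theorem theorem8:
  fixes M :: "'a measure"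
    and n :: nat and \<mu> :: real
    and a \<beta> lam :: "nat \<Rightarrow> real"
    and E :: "nat \<Rightarrow> real \<Rightarrow> 'a \<Rightarrow> real"
    and N :: "nat \<Rightarrow> real \<Rightarrow> 'a \<Rightarrow> nat"
    and N\<^sub>\<mu> :: "real \<Rightarrow> 'a \<Rightarrow> nat"
  defines "X \<equiv> iter_process a E N"
  defines "p \<equiv> (\<lambda>k t. measure M {\<omega> \<in> space M. N\<^sub>\<mu> (X n t \<omega>) \<omega> = k})"
  assumes "prob_space M"
    and "n \<ge> 1" and "\<mu> > 0"
    and "a 0 = 0" and "\<forall>i\<in>{1..n}. a i \<ge> 0"
    and "\<forall>i\<in>{1..n}. \<beta> i > 0 \<and> lam i > 0"
    and "\<forall>i\<in>{1..n}. prob_space.exponential_process M (\<beta> i) (E i)"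
    and "\<forall>i\<in>{1..n}. prob_space.poisson_process M (lam i) (N i)"
    and "prob_space.indep_vars M (\<lambda>_. path_space)
           (case_sum (\<lambda>i. sample_path (E i)) (\<lambda>i. sample_path (\<lambda>t \<omega>. real (N i t \<omega>))))
           ({1..n} <+> {1..n})"
    and "prob_space.poisson_process M \<mu> N\<^sub>\<mu>"
    and "prob_space.indep_var M path_space (sample_path (\<lambda>t \<omega>. real (N\<^sub>\<mu> t \<omega>))) path_space (sample_path (X n))"
  shows "((\<forall>i\<in>{1..n}. \<beta> i = 1 \<and> lam i = 1) \<longrightarrow>
            solves_shift_equation n (f_unit a n) \<mu> p) \<and>
         (\<forall>b l. b \<noteq> 1 \<and> l \<noteq> 1 \<and> (\<forall>i\<in>{1..n}. \<beta> i = b \<and> lam i = l) \<longrightarrow>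
            solves_shift_equation n (f_general l b a n) \<mu> p)"
proof -
  have *: "solves_shift_equation n (f_general l b a n) \<mu> p"
    if eq: "\<forall>i\<in>{1..n}. \<beta> i = b \<and> lam i = l" for b l
  proof -
    interpret prob_space M by fact
    \<comment> \<open>Positivity of the common values is read off at index 1, which exists because
      \<open>n \<ge> 1\<close>.\<close>
    have "1 \<in> {1..n}" using \<open>n \<ge> 1\<close> by simp
    then have pos: "b > 0" "l > 0" using assms(8) eq by auto
    interpret iterated_process M n b l a E N
    proof
      show "exponential_process b (E i)" "poisson_process l (N i)" "a i \<ge> 0" if "i \<in> {1..n}" for i
        using assms(7,9,10) eq that by auto
    qed (fact pos assms(11))+
    show ?thesis
      unfolding p_def X_def
      by (rule solves_shift_equation_f_general[OF assms(6,5,12) assms(13)[unfolded X_def]])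
  qed
  show ?thesis using *[of 1 1] * by (auto simp only: f_unit_eq_f_general)
qed

end
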